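(* Let $W:(\mathbb{R}^2,0)\to(\mathbb{R}^3,0)$ be a Whitney umbrella in Bruce-West normal form with coefficients $a_{ij}$, $b_i$ (see context), let $m\ge 1$ be an integer, let $c_w(x)=\left(x^{2m}\sum_{i\ge 0}c_i x^i,\ x^m\right)$ with $c_i\in\mathbb{R}$, and let $\gamma=W\circ c_w$. Then the curve $\gamma$, which passes through the Whitney umbrella singularity, is tangent at $x=0$ to the self-intersecting curve of $W$ if and only if $B=0$, where $$B=3c_0+\frac{b_3}{2}.$$
   Context: All maps are smooth map-germs. A map-germ $(\mathbb{R}^2,0)\to(\mathbb{R}^3,0)$ is a Whitney umbrella if, up to diffeomorphism-germs fixing the origin in source and target, it is equal to $(u,v)\mapsto(u,uv,v^2)^T$. Bruce-West normal form: for a fixed integer $k\ge 3$, $$W(u,v)=\begin{pmatrix}u\\ uv+\sum_{i=3}^{k}\frac{b_i}{i!}v^i+O(u,v)^{k+1}\\ \sum_{r=2}^{k}\sum_{i+j=r}\frac{a_{ij}}{i!\,j!}u^iv^j+O(u,v)^{k+1}\end{pmatrix},$$ with $a_{ij},b_i\in\mathbb{R}$ and $a_{02}\neq 0$, where $O(u,v)^{k+1}$ denotes terms of degree at least $k+1$. (Every Whitney umbrella takes this form after an orientation-preserving diffeomorphism of the source and a rotation of the target.) The expression $\sum_{i\ge0}c_ix^i$ is understood as the Taylor expansion at $0$ of a smooth function-germ. The self-intersecting curve of $W$ is the curve $W\circ d$, where $d:(\mathbb{R},0)\to(\mathbb{R}^2,0)$ is a regular curve-germ ($d'(0)\ne 0$)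 satisfying $W(d(x))=W(d(-x))$ for all $x$ near $0$; this is the double-point curve of $W$ through the singular value. Tangency at $x=0$: the curves $\gamma$ and $W\circ d$ both have vanishing or possibly vanishing derivative at $0$, but each derivative can be written as a power of $x$ times a smooth vector function not vanishing at $x=0$. The value at $0$ of this vector function spans the tangent line of the curve at the origin. Two curves are tangent at $x=0$ if these tangent lines coincide. *)

theory Defs
  imports "HOL-Analysis.Analysis"
begin

text \<open>
  A map-germ at a point is represented by a function defined on the whole space; only its
  values near the point matter, so every condition below is local at that point.
\<close>

primrec Ck_on :: "nat \<Rightarrow> 'a::euclidean_space set \<Rightarrow> ('a \<Rightarrow> 'b::euclidean_space) \<Rightarrow> bool" where
  "Ck_on 0 S f \<longleftrightarrow> continuous_on S f"
| "Ck_on (Suc n) S f \<longleftrightarrow> (\<forall>x\<in>S. f differentiable (at x)) \<and>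
     (\<forall>v. Ck_on n S (\<lambda>x. frechet_derivative f (at x) v))"

definition smooth_near :: "'a::euclidean_space \<Rightarrow> ('a \<Rightarrow> 'b::euclidean_space) \<Rightarrow> bool" where
  "smooth_near a f \<longleftrightarrow> (\<exists>S. open S \<and> a \<in> S \<and> (\<forall>n. Ck_on n S f))"

definition map_germ :: "('a::euclidean_space \<Rightarrow> 'b::euclidean_space) \<Rightarrow> bool" where
  "map_germ f \<longleftrightarrow> smooth_near 0 f \<and> f 0 = 0"

definition diffeo_germ :: "('a::euclidean_space \<Rightarrow> 'a) \<Rightarrow> bool" where
  "diffeo_germ f \<longleftrightarrow> map_germ f \<and>
     (\<exists>g. map_germ g \<and> (\<forall>\<^sub>F x in nhds 0. g (f x) = x) \<and> (\<forall>\<^sub>F x in nhds 0. f (g x) = x))"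

definition whitney_umbrella :: "(real^2 \<Rightarrow> real^3) \<Rightarrow> bool" where
  "whitney_umbrella W \<longleftrightarrow> map_germ W \<and>
     (\<exists>\<phi> \<psi>. diffeo_germ \<phi> \<and> diffeo_germ \<psi> \<and>
        (\<forall>\<^sub>F p in nhds 0. \<psi> (W (\<phi> p)) = vector [p$1, p$1 * p$2, (p$2)^2]))"

text \<open>
  The terms of degree at least \<open>k + 1\<close> are given by a Landau symbol; as all the functions
  involved are smooth, this says that the remainder has vanishing Taylor polynomial of
  degree \<open>k\<close> at the origin.
\<close>

definition bruce_west ::
  "nat \<Rightarrow> (nat \<Rightarrow> nat \<Rightarrow> real) \<Rightarrow> (nat \<Rightarrow> real) \<Rightarrow> (real^2 \<Rightarrow> real^3) \<Rightarrow> bool" where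
  "bruce_west k a b W \<longleftrightarrow> map_germ W \<and> a 0 2 \<noteq> 0 \<and>
     (\<forall>\<^sub>F p in nhds 0. W p $ 1 = p$1) \<and>
     (\<lambda>p. W p $ 2 - (p$1 * p$2 + (\<Sum>i=3..k. b i / fact i * (p$2)^i)))
        \<in> O[at 0](\<lambda>p. norm p ^ (k+1)) \<and>
     (\<lambda>p. W p $ 3 - (\<Sum>r=2..k. \<Sum>(i,j)\<in>{(i,j). i + j = r}.
              a i j / (fact i * fact j) * (p$1)^i * (p$2)^j))
        \<in> O[at 0](\<lambda>p. norm p ^ (k+1))"

definition taylor_at_0 :: "(real \<Rightarrow> real) \<Rightarrow> (nat \<Rightarrow> real) \<Rightarrow> bool" where
  "taylor_at_0 f c \<longleftrightarrow> smooth_near 0 f \<and> (\<forall>i. (deriv ^^ i) f 0 / fact i = c i)"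

text \<open>
  Since \<open>d'(0) \<noteq> 0\<close>, the points \<open>d x\<close> and \<open>d (- x)\<close> are distinct for small nonzero \<open>x\<close>, so
  \<open>d\<close> parametrizes the double points of \<open>W\<close>.
\<close>

definition double_point_curve :: "(real^2 \<Rightarrow> real^3) \<Rightarrow> (real \<Rightarrow> real^2) \<Rightarrow> bool" where
  "double_point_curve W d \<longleftrightarrow> map_germ d \<and> vector_derivative d (at 0) \<noteq> 0 \<and>
     (\<forall>\<^sub>F x in nhds 0. W (d x) = W (d (- x)))"

definition tangent_line_at_0 :: "(real \<Rightarrow> 'a::euclidean_space) \<Rightarrow> 'a set \<Rightarrow> bool" where
  "tangent_line_at_0 \<gamma> L \<longleftrightarrow>
     (\<exists>n g. smooth_near 0 g \<and> g 0 \<noteq> 0 \<and>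
        (\<forall>\<^sub>F x in nhds 0. (\<gamma> has_vector_derivative x ^ n *\<^sub>R g x) (at x)) \<and> L = span {g 0})"

definition tangent_at_0 ::
  "(real \<Rightarrow> 'a::euclidean_space) \<Rightarrow> (real \<Rightarrow> 'a) \<Rightarrow> bool" where
  "tangent_at_0 \<gamma> \<delta> \<longleftrightarrow> (\<exists>L. tangent_line_at_0 \<gamma> L \<and> tangent_line_at_0 \<delta> L)"

end

theory Submission
  imports Defs
begin

text \<open>
  Both curves pass through the singular point, where their tangent lines are spanned by leading
  coefficients: a smooth curve \<open>\<delta>\<close> with \<open>\<delta> x / x^N \<rightarrow> l \<noteq> 0\<close> has derivative \<open>x^(N-1)\<close> times a smooth
  factor that does not vanish at \<open>0\<close>, hence exactly one tangent line, the span of \<open>l\<close>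
  (\<open>tangent_line_at_0_leading_coefficient\<close>, \<open>tangent_line_at_0_unique\<close>). Smoothness of that
  factor rests on Hadamard's lemma (\<open>smooth_near_divide_by_variable\<close>).

  The leading coefficients come from weighing \<open>u\<close> twice as much as \<open>v\<close>. If \<open>u\<close> and \<open>v\<close> behave like
  \<open>\<alpha> s\<^sup>2\<close> and \<open>\<beta> s\<close> with \<open>\<beta> \<noteq> 0\<close>, then \<open>W\<close> behaves like \<open>s\<^sup>2 (\<alpha>, 0, a\<^sub>0\<^sub>2 \<beta>\<^sup>2 / 2)\<close>, and its second component
  like \<open>s\<^sup>3 (\<alpha> \<beta> + b\<^sub>3 \<beta>\<^sup>3 / 6)\<close> (\<open>bruce_west_leading_terms\<close>). Along \<open>c\<^sub>w\<close> one has \<open>s = x^m\<close>, \<open>\<alpha> = c\<^sub>0\<close> and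
  \<open>\<beta> = 1\<close>, so \<open>\<gamma>\<close> points in the direction \<open>(c\<^sub>0, 0, a\<^sub>0\<^sub>2 / 2)\<close>. Along the double-point curve one has
  \<open>s = x\<close>, and as \<open>W (d x) = W (d (- x))\<close> the coefficient of the odd power \<open>x\<^sup>3\<close> in the second
  component is zero; therefore \<open>\<alpha> = - b\<^sub>3 \<beta>\<^sup>2 / 6\<close> (\<open>double_point_curve_leading_terms\<close>), and \<open>W \<circ> d\<close>
  points in the direction \<open>(- b\<^sub>3 / 6, 0, a\<^sub>0\<^sub>2 / 2)\<close>. Because \<open>a\<^sub>0\<^sub>2 \<noteq> 0\<close>, the two lines coincide exactly
  when \<open>c\<^sub>0 = - b\<^sub>3 / 6\<close>, that is \<open>B = 0\<close>.
\<close>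


section \<open>Calculus of smooth germs\<close>

lemma Ck_on_SucD:
  assumes "Ck_on (Suc n) S f" and "x \<in> S"
  shows "(f has_derivative frechet_derivative f (at x)) (at x)"
  using assms frechet_derivative_works by auto

lemma Ck_on_cong:
  assumes S: "open S" and eq: "\<And>x. x \<in> S \<Longrightarrow> f x = g x" and "Ck_on n S f"
  shows "Ck_on n S g"
  using eq assms(3)
proof (induction n arbitrary: f g)
  case 0
  then show ?case by (simp cong: continuous_on_cong)
next
  case (Suc n)
  have D: "(g has_derivative frechet_derivative f (at x)) (at x)" if "x \<in> S" for x
    using has_derivative_transform_within_open[OF Ck_on_SucD[OF Suc.prems(2) that] S that]
      Suc.prems(1) by blast
  have "Ck_on n S (\<lambda>x. frechet_derivative g (at x) v)" for v
  proof (rule Suc.IH)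
    show "frechet_derivative f (at x) v = frechet_derivative g (at x) v" if "x \<in> S" for x
      using frechet_derivative_at[OF D[OF that]] by simp
  qed (use Suc.prems(2) in auto)
  then show ?case using D by (auto simp: differentiable_def)
qed

lemma Ck_on_Suc_derivI:
  assumes S: "open S" and D: "\<And>x. x \<in> S \<Longrightarrow> (f has_derivative f' x) (at x)"
    and f': "\<And>v. Ck_on n S (\<lambda>x. f' x v)"
  shows "Ck_on (Suc n) S f"
proof -
  have "Ck_on n S (\<lambda>x. frechet_derivative f (at x) v)" for v
  proof (rule Ck_on_cong[OF S _ f'])
    show "f' x v = frechet_derivative f (at x) v" if "x \<in> S" for x
      using frechet_derivative_at[OF D[OF that]] by simp
  qed
  then show ?thesis using D by (auto simp: differentiable_def)
qed

lemma Ck_on_lower: "Ck_on (Suc n) S f \<Longrightarrow> Ck_on n S f"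
proof (induction n arbitrary: f)
  case 0
  then show ?case
    by (auto intro!: continuous_at_imp_continuous_on differentiable_imp_continuous_within)
qed auto

lemma Ck_on_subset: "Ck_on n S f \<Longrightarrow> T \<subseteq> S \<Longrightarrow> Ck_on n T f"
  by (induction n arbitrary: f) (auto intro: continuous_on_subset)

lemma Ck_on_const: "open S \<Longrightarrow> Ck_on n S (\<lambda>x. c)"
proof (induction n arbitrary: c)
  case (Suc n)
  then show ?case by (intro Ck_on_Suc_derivI[where f' = "\<lambda>x v. 0"]) auto
qed simp

lemma Ck_on_bounded_linear:
  assumes S: "open S" and L: "bounded_linear L" and "Ck_on n S f"
  shows "Ck_on n S (\<lambda>x. L (f x))"
  using assms(3)
proof (induction n arbitrary: f)
  case 0
  then show ?case using L by (simp add: bounded_linear.continuous_on)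
next
  case (Suc n)
  show ?case
    using S
    by (rule Ck_on_Suc_derivI[where f' = "\<lambda>x v. L (frechet_derivative f (at x) v)"])
      (use Suc L in \<open>auto intro!: bounded_linear.has_derivative[OF L] Ck_on_SucD[OF Suc.prems]\<close>)
qed

lemma Ck_on_add:
  assumes S: "open S" and "Ck_on n S f" "Ck_on n S g"
  shows "Ck_on n S (\<lambda>x. f x + g x)"
  using assms(2,3)
proof (induction n arbitrary: f g)
  case 0
  then show ?case by (simp add: continuous_on_add)
next
  case (Suc n)
  show ?case
    using S
    by (rule Ck_on_Suc_derivI[where
          f' = "\<lambda>x v. frechet_derivative f (at x) v + frechet_derivative g (at x) v"])
      (use Suc in \<open>auto intro!: has_derivative_add Ck_on_SucD[OF Suc.prems(1)]
          Ck_on_SucD[OF Suc.prems(2)]\<close>)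
qed

lemma Ck_on_scaleR:
  assumes S: "open S" and "Ck_on n S f" "Ck_on n S g"
  shows "Ck_on n S (\<lambda>x. f x *\<^sub>R g x)"
  using assms(2,3)
proof (induction n arbitrary: f g)
  case 0
  then show ?case by (simp add: continuous_on_scaleR)
next
  case (Suc n)
  show ?case
    using S
  proof (rule Ck_on_Suc_derivI)
    fix x assume "x \<in> S"
    with Suc.prems
    have "(f has_derivative frechet_derivative f (at x)) (at x)"
      "(g has_derivative frechet_derivative g (at x)) (at x)"
      by (blast intro: Ck_on_SucD)+
    then show "((\<lambda>x. f x *\<^sub>R g x) has_derivative
        (\<lambda>v. f x *\<^sub>R frechet_derivative g (at x) v + frechet_derivative f (at x) v *\<^sub>R g x)) (at x)"
      by (rule has_derivative_scaleR)
  next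
    show "Ck_on n S (\<lambda>x. f x *\<^sub>R frechet_derivative g (at x) v
        + frechet_derivative f (at x) v *\<^sub>R g x)" for v
      using Suc.prems Suc.prems[THEN Ck_on_lower] by (intro Ck_on_add[OF S] Suc.IH) auto
  qed
qed

lemma Ck_on_sum:
  assumes "open S" and "\<And>i. i \<in> I \<Longrightarrow> Ck_on n S (f i)"
  shows "Ck_on n S (\<lambda>x. \<Sum>i\<in>I. f i x)"
  using assms(2)
  by (induction I rule: infinite_finite_induct)
    (auto intro: Ck_on_add[OF assms(1)] Ck_on_const[OF assms(1)])

text \<open>
  The chain rule expresses the derivative of a composition in the direction \<open>v\<close> as a
  combination of partial derivatives of the outer map, again composed with the inner one; this
  reduces the order by one with the inner map unchanged.
\<close>

lemma Ck_on_compose: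
  fixes f :: "'a::euclidean_space \<Rightarrow> 'b::euclidean_space" and g :: "'b \<Rightarrow> 'c::euclidean_space"
  assumes S: "open S" and fST: "f ` S \<subseteq> T" and "Ck_on n S f" "Ck_on n T g"
  shows "Ck_on n S (\<lambda>x. g (f x))"
  using assms(3,4)
proof (induction n arbitrary: g)
  case 0
  then show ?case using fST by (auto intro: continuous_on_compose2)
next
  case (Suc n)
  show ?case
    using S
  proof (rule Ck_on_Suc_derivI)
    fix x assume x: "x \<in> S"
    then have Dg: "(g has_derivative frechet_derivative g (at (f x))) (at (f x))"
      using Suc.prems fST by (intro Ck_on_SucD) auto
    have "frechet_derivative g (at (f x)) w
        = (\<Sum>i\<in>Basis. (w \<bullet> i) *\<^sub>R frechet_derivative g (at (f x)) i)" for w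
    proof -
      have lin: "linear (frechet_derivative g (at (f x)))"
        using Dg by (rule has_derivative_linear)
      have "frechet_derivative g (at (f x)) w
          = frechet_derivative g (at (f x)) (\<Sum>i\<in>Basis. (w \<bullet> i) *\<^sub>R i)"
        by (simp add: euclidean_representation)
      then show ?thesis by (simp add: linear_sum[OF lin] linear_cmul[OF lin])
    qed
    then show "((\<lambda>x. g (f x)) has_derivative (\<lambda>v. \<Sum>i\<in>Basis.
        (frechet_derivative f (at x) v \<bullet> i) *\<^sub>R frechet_derivative g (at (f x)) i)) (at x)"
      by (intro has_derivative_eq_rhs[OF has_derivative_compose[OF Ck_on_SucD[OF Suc.prems(1) x]
              Dg]] ext)
  next
    show "Ck_on n S (\<lambda>x. \<Sum>i\<in>Basis.
        (frechet_derivative f (at x) v \<bullet> i) *\<^sub>R frechet_derivative g (at (f x)) i)" for v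
      using Suc.prems Ck_on_lower[OF Suc.prems(1)]
      by (intro Ck_on_sum Ck_on_scaleR Suc.IH[of "\<lambda>y. frechet_derivative g (at y) i" for i]
          Ck_on_bounded_linear[OF _ bounded_linear_inner_left] S) auto
  qed
qed

lemma smooth_near_const: "smooth_near a (\<lambda>x. c)"
  unfolding smooth_near_def using Ck_on_const[of UNIV] by (intro exI[of _ UNIV]) auto

lemma smooth_near_ident: "smooth_near a (\<lambda>x. x)"
proof -
  have "Ck_on n UNIV (\<lambda>x::'a. x)" for n
    by (cases n) (auto intro!: Ck_on_Suc_derivI[where f' = "\<lambda>x v. v"] Ck_on_const)
  then show ?thesis unfolding smooth_near_def by (intro exI[of _ UNIV]) auto
qed

lemma smooth_near_bounded_linear:
  "bounded_linear L \<Longrightarrow> smooth_near a f \<Longrightarrow> smooth_near a (\<lambda>x. L (f x))"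
  unfolding smooth_near_def using Ck_on_bounded_linear by blast

lemma smooth_near_add:
  assumes "smooth_near a f" "smooth_near a g"
  shows "smooth_near a (\<lambda>x. f x + g x)"
proof -
  obtain S T where S: "open S" "a \<in> S" "\<And>n. Ck_on n S f"
    and T: "open T" "a \<in> T" "\<And>n. Ck_on n T g"
    using assms unfolding smooth_near_def by blast
  have "Ck_on n (S \<inter> T) (\<lambda>x. f x + g x)" for n
    by (rule Ck_on_add[OF _ Ck_on_subset[OF S(3)] Ck_on_subset[OF T(3)]]) (use S T in auto)
  then show ?thesis
    unfolding smooth_near_def using S(1,2) T(1,2) by (intro exI[of _ "S \<inter> T"]) auto
qed

lemma smooth_near_scaleR:
  assumes "smooth_near a f" "smooth_near a g"
  shows "smooth_near a (\<lambda>x. f x *\<^sub>R g x)"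
proof -
  obtain S T where S: "open S" "a \<in> S" "\<And>n. Ck_on n S f"
    and T: "open T" "a \<in> T" "\<And>n. Ck_on n T g"
    using assms unfolding smooth_near_def by blast
  have "Ck_on n (S \<inter> T) (\<lambda>x. f x *\<^sub>R g x)" for n
    by (rule Ck_on_scaleR[OF _ Ck_on_subset[OF S(3)] Ck_on_subset[OF T(3)]]) (use S T in auto)
  then show ?thesis
    unfolding smooth_near_def using S(1,2) T(1,2) by (intro exI[of _ "S \<inter> T"]) auto
qed

lemma smooth_near_power:
  fixes f :: "'a::euclidean_space \<Rightarrow> real"
  assumes "smooth_near a f"
  shows "smooth_near a (\<lambda>x. f x ^ n)"
proof (induction n)
  case (Suc n)
  show ?case using smooth_near_scaleR[OF assms Suc] by simp
qed (simp add: smooth_near_const)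

lemma smooth_near_compose:
  assumes "smooth_near a f" "smooth_near (f a) g"
  shows "smooth_near a (\<lambda>x. g (f x))"
proof -
  obtain S T where S: "open S" "a \<in> S" "\<And>n. Ck_on n S f"
    and T: "open T" "f a \<in> T" "\<And>n. Ck_on n T g"
    using assms unfolding smooth_near_def by blast
  have o: "open (S \<inter> f -` T)"
    using continuous_open_preimage[OF _ S(1) T(1)] S(3)[of 0] by simp
  have "Ck_on n (S \<inter> f -` T) (\<lambda>x. g (f x))" for n
    by (rule Ck_on_compose[OF o _ Ck_on_subset[OF S(3)] T(3)]) auto
  then show ?thesis
    unfolding smooth_near_def using o S(2) T(2) by (intro exI[of _ "S \<inter> f -` T"]) auto
qed

lemma smooth_near_frechet_derivative:
  assumes "smooth_near a f"
  shows "smooth_near a (\<lambda>x. frechet_derivative f (at x) v)"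
proof -
  obtain S where S: "open S" "a \<in> S" "\<And>n. Ck_on n S f"
    using assms unfolding smooth_near_def by blast
  have "Ck_on n S (\<lambda>x. frechet_derivative f (at x) v)" for n
    using S(3)[of "Suc n"] by simp
  then show ?thesis unfolding smooth_near_def using S(1,2) by blast
qed

lemma smooth_near_has_derivative:
  assumes "smooth_near a f"
  shows "\<forall>\<^sub>F x in nhds a. (f has_derivative frechet_derivative f (at x)) (at x)"
proof -
  obtain S where S: "open S" "a \<in> S" "\<And>n. Ck_on n S f"
    using assms unfolding smooth_near_def by blast
  show ?thesis
    using eventually_nhds_in_open[OF S(1,2)]
    by eventually_elim (rule Ck_on_SucD[OF S(3)[of "Suc 0"]])
qed

lemma smooth_near_has_vector_derivative:
  fixes f :: "real \<Rightarrow> 'a::euclidean_space"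
  assumes "smooth_near a f"
  shows "\<forall>\<^sub>F x in nhds a. (f has_vector_derivative frechet_derivative f (at x) 1) (at x)"
  using smooth_near_has_derivative[OF assms]
proof eventually_elim
  case (elim x)
  have "frechet_derivative f (at x) t = t *\<^sub>R frechet_derivative f (at x) 1" for t
    using linear_cmul[OF has_derivative_linear[OF elim], of t 1] by (simp only: real_scaleR_def mult_1_right)
  then show ?case
    unfolding has_vector_derivative_def by (intro has_derivative_eq_rhs[OF elim] ext)
qed

lemma smooth_near_isCont: "smooth_near a f \<Longrightarrow> isCont f a"
  by (rule has_derivative_continuous[OF eventually_nhds_x_imp_x[OF smooth_near_has_derivative]])

lemma eventually_nhds_imp_at: "\<forall>\<^sub>F x in nhds a. P x \<Longrightarrow> \<forall>\<^sub>F x in at a. P x"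
  by (rule filter_leD[OF at_within_le_nhds])


section \<open>Division of a smooth germ by powers of the variable\<close>

text \<open>
  Functions of one real variable are handled through the sequence of their successive derivatives
  instead of directional derivatives: such a sequence can be written down explicitly for the
  quotient in Hadamard's lemma.
\<close>

lemma Ck_on_vector_derivatives:
  fixes F :: "nat \<Rightarrow> real \<Rightarrow> 'a::euclidean_space"
  assumes S: "open S"
    and F: "\<And>j x. x \<in> S \<Longrightarrow> (F j has_vector_derivative F (Suc j) x) (at x)"
  shows "Ck_on n S (F j)"
proof -
  have "Ck_on n S (\<lambda>x. v *\<^sub>R F j x)" for v
  proof (induction n arbitrary: j v)
    case 0
    have "continuous_on S (F j)"
      using F by (meson continuous_at_imp_continuous_on has_vector_derivative_continuous)
    then show ?case by (simp add: continuous_on_scaleR)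
  next
    case (Suc n)
    show ?case
      using S
    proof (rule Ck_on_Suc_derivI)
      show "((\<lambda>x. v *\<^sub>R F j x) has_derivative (\<lambda>w. (w * v) *\<^sub>R F (Suc j) x)) (at x)"
        if "x \<in> S" for x
        using has_derivative_scaleR_right[OF F[OF that, unfolded has_vector_derivative_def], of v j]
        by (simp add: mult.commute)
    qed (rule Suc.IH)
  qed
  from this[of 1] show ?thesis by simp
qed

lemma smooth_near_derivative_sequence:
  fixes f :: "real \<Rightarrow> 'a::euclidean_space"
  assumes "smooth_near a f"
  obtains e F where "e > 0" "F 0 = f"
    "\<And>j x. x \<in> ball a e \<Longrightarrow> (F j has_vector_derivative F (Suc j) x) (at x)"
proof -
  obtain S where S: "open S" "a \<in> S" "\<And>n. Ck_on n S f"
    using assms unfolding smooth_near_def by blast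
  define F where "F = rec_nat f (\<lambda>_ h x. frechet_derivative h (at x) 1)"
  have F: "F 0 = f" "F (Suc j) = (\<lambda>x. frechet_derivative (F j) (at x) 1)" for j
    by (auto simp: F_def)
  have Ck: "Ck_on n S (F j)" for n j
  proof (induction j arbitrary: n)
    case (Suc j)
    from Suc[of "Suc n"] show ?case by (auto simp: F)
  qed (simp add: F S)
  have sm: "smooth_near x (F j)" if "x \<in> S" for x j
    unfolding smooth_near_def using Ck S that by auto
  obtain e where e: "e > 0" "ball a e \<subseteq> S" using S open_contains_ball by blast
  show thesis
  proof (rule that[of e F, OF e(1) F(1)])
    show "(F j has_vector_derivative F (Suc j) x) (at x)" if "x \<in> ball a e" for j x
      using smooth_near_has_vector_derivative[OF sm, THEN eventually_nhds_x_imp_x] that e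
      by (auto simp: F)
  qed
qed

lemma has_vector_derivative_scaled_argument:
  assumes "(f has_vector_derivative D) (at (t * x))"
  shows "((\<lambda>y. f (t * y)) has_vector_derivative t *\<^sub>R D) (at (x::real))"
proof -
  have "((\<lambda>y. t * y) has_vector_derivative t) (at x)"
    by (auto intro!: derivative_eq_intros)
  from vector_diff_chain_at[OF this assms] show ?thesis by (simp add: o_def)
qed

text \<open>
  Hadamard's lemma in one variable. The quotient \<open>f x / x\<close> is the average of \<open>f'\<close> over the
  segment from \<open>0\<close> to \<open>x\<close>, i.e. the integral of \<open>f' (t x)\<close> over \<open>t\<close> in the unit interval, which
  can be differentiated under the integral sign as often as one likes.
\<close>

lemma smooth_near_divide_by_variable:
  fixes f :: "real \<Rightarrow> 'a::euclidean_space"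
  assumes "smooth_near 0 f" "f 0 = 0"
  obtains g where "smooth_near 0 g" "\<forall>\<^sub>F x in nhds 0. f x = x *\<^sub>R g x"
proof -
  obtain e F where e: "e > 0" and F0: "F 0 = f"
    and F: "\<And>j x. x \<in> ball 0 e \<Longrightarrow> (F j has_vector_derivative F (Suc j) x) (at x)"
    using smooth_near_derivative_sequence[OF assms(1)] by blast
  let ?B = "ball (0::real) e"
  have tx: "t * x \<in> ?B" if "x \<in> ?B" "t \<in> cbox 0 1" for t x
  proof -
    have "\<bar>t * x\<bar> \<le> 1 * \<bar>x\<bar>" using that unfolding abs_mult by (intro mult_right_mono) auto
    then show ?thesis using that by simp
  qed
  have contF: "continuous_on ?B (F j)" for j
    using F by (meson continuous_at_imp_continuous_on has_vector_derivative_continuous)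
  have contF2: "continuous_on (?B \<times> cbox 0 1) (\<lambda>(x,t). t ^ i *\<^sub>R F j (t * x))" for i j
    unfolding split_def
    by (intro continuous_intros continuous_on_compose2[OF contF]) (use tx in auto)
  have contF1: "continuous_on (cbox 0 1) (\<lambda>t. t ^ i *\<^sub>R F j (t * x))" if "x \<in> ?B" for i j x
    by (intro continuous_intros continuous_on_compose2[OF contF]) (use tx[OF that] in auto)
  \<comment> \<open>\<open>G n\<close> is the \<open>n\<close>-th derivative of the quotient \<open>G 0\<close>; each differentiation of \<open>f' (t x)\<close>
    in \<open>x\<close> contributes a factor \<open>t\<close>.\<close>
  define G where "G n x = integral (cbox 0 1) (\<lambda>t. t ^ n *\<^sub>R F (Suc n) (t * x))" for n x
  have "(G n has_vector_derivative G (Suc n) x) (at x)" if x: "x \<in> ?B" for n x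
  proof -
    have "(G n has_vector_derivative G (Suc n) x) (at x within ?B)"
      unfolding G_def
    proof (rule leibniz_rule_vector_derivative)
      fix y t :: real assume y: "y \<in> ?B" and t: "t \<in> cbox 0 1"
      have "((\<lambda>y. F (Suc n) (t * y)) has_vector_derivative t *\<^sub>R F (Suc (Suc n)) (t * y)) (at y)"
        by (rule has_vector_derivative_scaled_argument[OF F[OF tx[OF y t]]])
      from bounded_linear.has_vector_derivative[OF bounded_linear_scaleR_right this]
      have "((\<lambda>y. t ^ n *\<^sub>R F (Suc n) (t * y)) has_vector_derivative
          t ^ n *\<^sub>R t *\<^sub>R F (Suc (Suc n)) (t * y)) (at y)"
        .
      then show "((\<lambda>y. t ^ n *\<^sub>R F (Suc n) (t * y)) has_vector_derivative
          t ^ Suc n *\<^sub>R F (Suc (Suc n)) (t * y)) (at y within ?B)"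
        by (simp add: mult.commute has_vector_derivative_at_within)
    next
      show "(\<lambda>t. t ^ n *\<^sub>R F (Suc n) (t * y)) integrable_on cbox 0 1" if "y \<in> ?B" for y
        by (rule integrable_continuous[OF contF1[OF that]])
    qed (fact x contF2 convex_ball)+
    then show ?thesis using x by (simp add: at_within_open[of x ?B])
  qed
  then have G: "Ck_on n ?B (G 0)" for n by (intro Ck_on_vector_derivatives) auto
  have "f x = x *\<^sub>R G 0 x" if x: "x \<in> ?B" for x
  proof -
    have "((\<lambda>t. x *\<^sub>R F 1 (t * x)) has_integral f (1 * x) - f (0 * x)) {0..1}"
    proof (rule fundamental_theorem_of_calculus)
      fix t :: real assume "t \<in> {0..1}"
      then have "t * x \<in> ?B" by (intro tx x) simp
      then have "(f has_vector_derivative F 1 (x * t)) (at (x * t))"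
        using F[of "t * x" 0] by (simp add: F0 mult.commute)
      from has_vector_derivative_scaled_argument[OF this]
      have "((\<lambda>t. f (t * x)) has_vector_derivative x *\<^sub>R F 1 (t * x)) (at t)"
        by (simp add: mult.commute)
      then show "((\<lambda>t. f (t * x)) has_vector_derivative x *\<^sub>R F 1 (t * x)) (at t within {0..1})"
        by (rule has_vector_derivative_at_within)
    qed simp
    from integral_unique[OF this] show ?thesis using assms(2) by (simp add: G_def)
  qed
  then have "\<forall>\<^sub>F x in nhds 0. f x = x *\<^sub>R G 0 x"
    unfolding eventually_nhds using e by (intro exI[of _ ?B]) auto
  moreover have "smooth_near 0 (G 0)"
    unfolding smooth_near_def using G e by (intro exI[of _ ?B]) auto
  ultimately show thesis using that by blast
qed

lemma smooth_near_divide_by_power: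
  fixes f :: "real \<Rightarrow> 'a::euclidean_space"
  assumes "smooth_near 0 f" and "((\<lambda>x. f x /\<^sub>R x ^ N) \<longlongrightarrow> l) (at 0)"
  obtains h where "smooth_near 0 h" "h 0 = l" "\<forall>\<^sub>F x in at 0. f x = x ^ N *\<^sub>R h x"
  using assms(2)
proof (induction N arbitrary: l thesis)
  case 0
  have "(f \<longlongrightarrow> f 0) (at 0)" using smooth_near_isCont[OF assms(1)] by (simp add: isCont_def)
  moreover have "(f \<longlongrightarrow> l) (at 0)" using 0(2) by simp
  ultimately have "f 0 = l" by (rule LIM_unique)
  then show ?case by (intro 0(1)[OF assms(1)]) simp_all
next
  case (Suc N)
  have "((\<lambda>x. x *\<^sub>R (f x /\<^sub>R x ^ Suc N)) \<longlongrightarrow> 0 *\<^sub>R l) (at 0)"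
    by (intro tendsto_intros Suc.prems)
  moreover have "\<forall>\<^sub>F x in at 0. x *\<^sub>R (f x /\<^sub>R x ^ Suc N) = f x /\<^sub>R x ^ N"
    unfolding eventually_at_filter by (auto simp: field_simps)
  ultimately have "((\<lambda>x. f x /\<^sub>R x ^ N) \<longlongrightarrow> 0 *\<^sub>R l) (at 0)"
    by (rule Lim_transform_eventually)
  then obtain h where h: "smooth_near 0 h" "h 0 = 0" "\<forall>\<^sub>F x in at 0. f x = x ^ N *\<^sub>R h x"
    by (rule Suc.IH[rotated]) simp_all
  obtain g where g: "smooth_near 0 g" "\<forall>\<^sub>F x in nhds 0. h x = x *\<^sub>R g x"
    using smooth_near_divide_by_variable[OF h(1,2)] by blast
  have f: "\<forall>\<^sub>F x in at 0. f x = x ^ Suc N *\<^sub>R g x"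
    using h(3) eventually_nhds_imp_at[OF g(2)]
    by eventually_elim (simp add: mult.commute)
  have "\<forall>\<^sub>F x in at 0. f x /\<^sub>R x ^ Suc N = g x"
    using f eventually_neq_at_within[of 0]
    by eventually_elim (simp del: power_Suc)
  with Suc.prems(2) have "(g \<longlongrightarrow> l) (at 0)"
    by (rule Lim_transform_eventually)
  moreover have "(g \<longlongrightarrow> g 0) (at 0)"
    using smooth_near_isCont[OF g(1)] by (simp add: isCont_def)
  ultimately have "g 0 = l" using LIM_unique by blast
  then show ?case using Suc.prems(1)[OF g(1) _ f] by blast
qed


section \<open>Tangent lines\<close>

lemma span_singleton_scaleR:
  fixes v :: "'a::real_vector"
  assumes "c \<noteq> 0"
  shows "span {c *\<^sub>R v} = span {v}"
proof (rule span_eq[THEN iffD2], intro conjI)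
  show "{c *\<^sub>R v} \<subseteq> span {v}" by (simp add: span_base span_scale)
  have "inverse c *\<^sub>R (c *\<^sub>R v) \<in> span {c *\<^sub>R v}" by (intro span_scale span_base) simp
  then show "{v} \<subseteq> span {c *\<^sub>R v}" using assms by simp
qed

text \<open>
  The leading coefficient of a curve spans its tangent line: if \<open>\<gamma> x = x^N h x\<close> then the
  derivative of \<open>\<gamma>\<close> is \<open>x^(N-1)\<close> times \<open>N h x + x h' x\<close>, whose value at \<open>0\<close> is \<open>N h 0\<close>.
\<close>

lemma tangent_line_at_0_leading_coefficient:
  fixes \<gamma> :: "real \<Rightarrow> 'a::euclidean_space"
  assumes "smooth_near 0 \<gamma>" "\<gamma> 0 = 0" and lim: "((\<lambda>x. \<gamma> x /\<^sub>R x ^ N) \<longlongrightarrow> l) (at 0)"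
    and "l \<noteq> 0" "N > 0"
  shows "tangent_line_at_0 \<gamma> (span {l})"
proof -
  obtain h where h: "smooth_near 0 h" "h 0 = l" "\<forall>\<^sub>F x in at 0. \<gamma> x = x ^ N *\<^sub>R h x"
    using smooth_near_divide_by_power[OF assms(1) lim] by blast
  have "\<forall>\<^sub>F x in nhds 0. \<gamma> x = x ^ N *\<^sub>R h x"
    using h(3) unfolding eventually_at_filter
  proof eventually_elim
    case (elim x)
    then show ?case using assms(2) \<open>N > 0\<close> by (cases "x = 0") auto
  qed
  then have ev: "\<forall>\<^sub>F x in nhds 0. \<forall>\<^sub>F y in nhds x. \<gamma> y = y ^ N *\<^sub>R h y"
    by (simp add: eventually_eventually)
  let ?g = "\<lambda>x. real N *\<^sub>R h x + x *\<^sub>R frechet_derivative h (at x) 1"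
  have "\<forall>\<^sub>F x in nhds 0. (\<gamma> has_vector_derivative x ^ (N - 1) *\<^sub>R ?g x) (at x)"
    using ev smooth_near_has_vector_derivative[OF h(1)]
  proof eventually_elim
    case (elim x)
    have "((\<lambda>x. x ^ N *\<^sub>R h x) has_vector_derivative
        x ^ N *\<^sub>R frechet_derivative h (at x) 1 + (real N * x ^ (N - 1)) *\<^sub>R h x) (at x)"
      by (intro has_vector_derivative_scaleR elim) (auto intro!: derivative_eq_intros)
    also have "x ^ N = x ^ (N - 1) * x" using \<open>N > 0\<close> by (metis power_minus_mult)
    finally have *: "((\<lambda>x. x ^ N *\<^sub>R h x) has_vector_derivative x ^ (N - 1) *\<^sub>R ?g x) (at x)"
      by (simp add: algebra_simps)
    have near: "\<forall>\<^sub>F y in nhds x. y ^ N *\<^sub>R h y = \<gamma> y"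
      using elim(1) by eventually_elim simp
    from * show ?case
      unfolding has_vector_derivative_def
      by (rule has_derivative_transform_eventually)
        (fact eventually_nhds_imp_at[OF near] eventually_nhds_x_imp_x[OF near] UNIV_I)+
  qed
  moreover have "smooth_near 0 ?g"
    using h(1) by (intro smooth_near_add smooth_near_scaleR smooth_near_const smooth_near_ident
        smooth_near_frechet_derivative)
  moreover have "span {l} = span {?g 0}"
    using h(2) \<open>N > 0\<close> by (simp add: span_singleton_scaleR)
  moreover have "?g 0 \<noteq> 0" using h(2) \<open>N > 0\<close> \<open>l \<noteq> 0\<close> by simp
  ultimately show ?thesis
    unfolding tangent_line_at_0_def by blast
qed

text \<open>
  Two factorizations of the same derivative must have the same exponent, since otherwise one
  of the two nonvanishing factors would tend to \<open>0\<close>.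
\<close>

lemma tangent_line_at_0_unique:
  assumes "tangent_line_at_0 \<gamma> L" "tangent_line_at_0 \<gamma> L'"
  shows "L = L'"
proof -
  have main: "g 0 = g' 0"
    if g: "smooth_near 0 g" "g 0 \<noteq> 0" "smooth_near 0 g'" "g' 0 \<noteq> (0::'a)"
      and eq: "\<forall>\<^sub>F x in nhds 0. x ^ n *\<^sub>R g x = x ^ n' *\<^sub>R g' x" and "n \<le> n'"
    for g g' :: "real \<Rightarrow> 'a" and n n'
  proof -
    have "\<forall>\<^sub>F x in at 0. g x = x ^ (n' - n) *\<^sub>R g' x"
      using eventually_nhds_imp_at[OF eq] eventually_neq_at_within[of 0]
    proof eventually_elim
      case (elim x)
      have "x ^ n' = x ^ n * x ^ (n' - n)" using \<open>n \<le> n'\<close> by (simp flip: power_add)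
      then have "x ^ n *\<^sub>R g x = x ^ n *\<^sub>R (x ^ (n' - n) *\<^sub>R g' x)" using elim by simp
      then show ?case using elim by (metis power_not_zero scaleR_left_imp_eq)
    qed
    moreover have "((\<lambda>x. x ^ (n' - n) *\<^sub>R g' x) \<longlongrightarrow> 0 ^ (n' - n) *\<^sub>R g' 0) (at 0)"
      using smooth_near_isCont[OF g(3)] by (intro tendsto_intros) (simp add: isCont_def)
    ultimately have "(g \<longlongrightarrow> 0 ^ (n' - n) *\<^sub>R g' 0) (at 0)"
      by (simp only: tendsto_cong)
    moreover have "(g \<longlongrightarrow> g 0) (at 0)"
      using smooth_near_isCont[OF g(1)] by (simp add: isCont_def)
    ultimately have "g 0 = 0 ^ (n' - n) *\<^sub>R g' 0" by (rule LIM_unique[rotated])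
    then show ?thesis using g(2) by (cases "n' - n") auto
  qed
  obtain n g n' g' where g: "smooth_near 0 g" "g 0 \<noteq> 0" "smooth_near 0 g'" "g' 0 \<noteq> 0"
    and L: "L = span {g 0}" "L' = span {g' 0}"
    and D: "\<forall>\<^sub>F x in nhds 0. (\<gamma> has_vector_derivative x ^ n *\<^sub>R g x) (at x)"
      "\<forall>\<^sub>F x in nhds 0. (\<gamma> has_vector_derivative x ^ n' *\<^sub>R g' x) (at x)"
    using assms unfolding tangent_line_at_0_def by blast
  have eq: "\<forall>\<^sub>F x in nhds 0. x ^ n *\<^sub>R g x = x ^ n' *\<^sub>R g' x"
    using D by eventually_elim (rule vector_derivative_unique_at)
  then have eq': "\<forall>\<^sub>F x in nhds 0. x ^ n' *\<^sub>R g' x = x ^ n *\<^sub>R g x"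
    by eventually_elim simp
  have "g 0 = g' 0"
    using main[OF g eq] main[OF g(3,4,1,2) eq', symmetric] by (rule linorder_le_cases)
  then show ?thesis using L by simp
qed


section \<open>Leading terms along curves through the umbrella point\<close>

text \<open>
  The first coordinate of \<open>p\<close> has weight \<open>2\<close> and the second one weight \<open>1\<close> in the small
  parameter \<open>s\<close>; only monomials of weight exactly \<open>n\<close> survive division by \<open>s ^ n\<close>.
\<close>

lemma weighted_monomial_limit:
  fixes u v s :: "'x \<Rightarrow> real"
  assumes s: "filterlim s (at 0) F"
    and u: "((\<lambda>x. u x / s x ^ 2) \<longlongrightarrow> \<alpha>) F" and v: "((\<lambda>x. v x / s x) \<longlongrightarrow> \<beta>) F"
    and n: "n \<le> 2 * i + j"
  shows "((\<lambda>x. u x ^ i * v x ^ j / s x ^ n) \<longlongrightarrow> (if 2 * i + j = n then \<alpha> ^ i * \<beta> ^ j else 0)) F"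
proof -
  have s0: "(s \<longlongrightarrow> 0) F" and sn: "\<forall>\<^sub>F x in F. s x \<noteq> 0"
    using s unfolding filterlim_at by auto
  have "((\<lambda>x. (u x / s x ^ 2) ^ i * (v x / s x) ^ j * s x ^ (2 * i + j - n))
      \<longlongrightarrow> \<alpha> ^ i * \<beta> ^ j * 0 ^ (2 * i + j - n)) F"
    by (intro tendsto_intros u v s0)
  moreover have "\<forall>\<^sub>F x in F. (u x / s x ^ 2) ^ i * (v x / s x) ^ j * s x ^ (2 * i + j - n)
      = u x ^ i * v x ^ j / s x ^ n"
    using sn
  proof eventually_elim
    case (elim x)
    have "s x ^ (2 * i + j) = s x ^ n * s x ^ (2 * i + j - n)"
      using n by (simp flip: power_add)
    then have "u x ^ i * v x ^ j / s x ^ n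
        = u x ^ i * v x ^ j * s x ^ (2 * i + j - n) / s x ^ (2 * i + j)"
      using elim by simp
    then show ?case by (simp add: power_divide power_add power_mult)
  qed
  ultimately have "((\<lambda>x. u x ^ i * v x ^ j / s x ^ n)
      \<longlongrightarrow> \<alpha> ^ i * \<beta> ^ j * 0 ^ (2 * i + j - n)) F"
    by (rule Lim_transform_eventually)
  also have "\<alpha> ^ i * \<beta> ^ j * 0 ^ (2 * i + j - n) = (if 2 * i + j = n then \<alpha> ^ i * \<beta> ^ j else 0)"
    using n by simp
  finally show ?thesis .
qed

text \<open>
  Both coordinates of \<open>p\<close> are \<open>O(s)\<close>, so a remainder of order \<open>N > n\<close> at the origin is
  \<open>o(s ^ n)\<close> along \<open>p\<close>. As \<open>\<beta> \<noteq> 0\<close>, the curve \<open>p\<close> avoids the origin, where the remainder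
  is not controlled.
\<close>

lemma remainder_along_curve:
  fixes p :: "'x \<Rightarrow> real^2" and s :: "'x \<Rightarrow> real" and R :: "real^2 \<Rightarrow> real"
  assumes s: "filterlim s (at 0) F"
    and u: "((\<lambda>x. p x $ 1 / s x ^ 2) \<longlongrightarrow> \<alpha>) F" and v: "((\<lambda>x. p x $ 2 / s x) \<longlongrightarrow> \<beta>) F"
    and "\<beta> \<noteq> 0" and R: "R \<in> O[at 0](\<lambda>y. norm y ^ N)" and "n < N"
  shows "((\<lambda>x. R (p x) / s x ^ n) \<longlongrightarrow> 0) F"
proof -
  have s0: "(s \<longlongrightarrow> 0) F" and sn: "\<forall>\<^sub>F x in F. s x \<noteq> 0"
    using s unfolding filterlim_at by auto
  \<comment> \<open>The rescaled curve has a limit, so \<open>norm (p x)\<close> is bounded by a multiple of \<open>\<bar>s x\<bar>\<close>.\<close>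
  define q where "q x = p x /\<^sub>R s x" for x
  have "((\<lambda>x. p x $ 1 / s x ^ 2 * s x) \<longlongrightarrow> \<alpha> * 0) F"
    by (intro tendsto_intros u s0)
  moreover have "\<forall>\<^sub>F x in F. p x $ 1 / s x ^ 2 * s x = q x $ 1"
    using sn by eventually_elim (simp add: q_def field_simps power2_eq_square)
  ultimately have q1: "((\<lambda>x. q x $ 1) \<longlongrightarrow> \<alpha> * 0) F"
    by (rule Lim_transform_eventually)
  have q2: "((\<lambda>x. q x $ 2) \<longlongrightarrow> \<beta>) F"
    using v by (simp add: q_def divide_inverse_commute)
  have q: "(q \<longlongrightarrow> vector [0, \<beta>]) F"
  proof (rule vec_tendstoI)
    show "((\<lambda>x. q x $ i) \<longlongrightarrow> (vector [0, \<beta>] :: real^2) $ i) F" for i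
      using exhaust_2[of i] q1 q2 by auto
  qed
  have p_eq: "\<forall>\<^sub>F x in F. p x = s x *\<^sub>R q x"
    using sn by eventually_elim (simp add: q_def)
  have "((\<lambda>x. s x *\<^sub>R q x) \<longlongrightarrow> 0 *\<^sub>R vector [0, \<beta>]) F"
    by (intro tendsto_intros s0 q)
  then have "(p \<longlongrightarrow> 0) F"
    using p_eq by (simp add: tendsto_cong)
  moreover have "\<forall>\<^sub>F x in F. p x \<noteq> 0"
    using tendsto_imp_eventually_ne[OF v \<open>\<beta> \<noteq> 0\<close>] by eventually_elim auto
  ultimately have p: "filterlim p (at 0) F"
    by (simp add: filterlim_at)
  obtain K where "\<forall>\<^sub>F y in at 0. norm (R y) \<le> K * norm (norm y ^ N)"
    using R by (rule landau_o.bigE)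
  from eventually_compose_filterlim[OF this p]
  have bound: "\<forall>\<^sub>F x in F. norm (R (p x) / s x ^ n) \<le> K * norm (q x) ^ N * \<bar>s x\<bar> ^ (N - n)"
    using sn p_eq
  proof eventually_elim
    case (elim x)
    have "\<bar>s x\<bar> ^ N = \<bar>s x\<bar> ^ n * \<bar>s x\<bar> ^ (N - n)"
      using \<open>n < N\<close> by (simp flip: power_add)
    moreover have "norm (p x) = \<bar>s x\<bar> * norm (q x)" using arg_cong[OF elim(3), of norm] by simp
    moreover have "\<bar>R (p x)\<bar> \<le> K * norm (p x) ^ N" using elim(1) by simp
    ultimately have "\<bar>R (p x)\<bar> \<le> K * norm (q x) ^ N * \<bar>s x\<bar> ^ (N - n) * \<bar>s x\<bar> ^ n"
      by (simp only: power_mult_distrib ac_simps)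
    then show ?case
      using elim(2) by (simp add: power_abs pos_divide_le_eq)
  qed
  have "((\<lambda>x. K * norm (q x) ^ N * \<bar>s x\<bar> ^ (N - n))
      \<longlongrightarrow> K * norm (vector [0, \<beta>] :: real^2) ^ N * \<bar>0\<bar> ^ (N - n)) F"
    by (intro tendsto_intros q s0)
  then have "((\<lambda>x. K * norm (q x) ^ N * \<bar>s x\<bar> ^ (N - n)) \<longlongrightarrow> 0) F"
    using \<open>n < N\<close> by (simp add: power_0_left)
  with bound show ?thesis by (rule Lim_null_comparison)
qed

text \<open>
  In the second component of \<open>W\<close> the terms \<open>u v\<close> and \<open>b\<^sub>3 v\<^sup>3 / 6\<close> have weight \<open>3\<close> and all others
  have larger weight; in the third one \<open>a\<^sub>0\<^sub>2 v\<^sup>2 / 2\<close> is the only term of weight \<open>2\<close>.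
\<close>

lemma bruce_west_leading_terms:
  fixes p :: "'x \<Rightarrow> real^2" and s :: "'x \<Rightarrow> real"
  assumes W: "bruce_west k a b W" and k: "k \<ge> 3" and s: "filterlim s (at 0) F"
    and u: "((\<lambda>x. p x $ 1 / s x ^ 2) \<longlongrightarrow> \<alpha>) F" and v: "((\<lambda>x. p x $ 2 / s x) \<longlongrightarrow> \<beta>) F"
    and p: "(p \<longlongrightarrow> 0) F" and "\<beta> \<noteq> 0"
  shows "((\<lambda>x. W (p x) $ 2 / s x ^ 3) \<longlongrightarrow> \<alpha> * \<beta> + b 3 / 6 * \<beta> ^ 3) F" (is ?second)
    and "((\<lambda>x. W (p x) /\<^sub>R s x ^ 2) \<longlongrightarrow> vector [\<alpha>, 0, a 0 2 / 2 * \<beta> ^ 2]) F" (is ?all)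
proof -
  have s0: "(s \<longlongrightarrow> 0) F" and sn: "\<forall>\<^sub>F x in F. s x \<noteq> 0"
    using s unfolding filterlim_at by auto
  note monomial = weighted_monomial_limit[OF s u v]
  note remainder = remainder_along_curve[OF s u v \<open>\<beta> \<noteq> 0\<close>]
  let ?P2 = "\<lambda>y::real^2. y$1 * y$2 + (\<Sum>i=3..k. b i / fact i * (y$2)^i)"
  let ?P3 = "\<lambda>y::real^2. \<Sum>r=2..k. \<Sum>(i,j)\<in>{(i,j). i + j = r}.
      a i j / (fact i * fact j) * (y$1)^i * (y$2)^j"
  have W1: "\<forall>\<^sub>F y in nhds 0. W y $ 1 = y $ 1"
    and W2: "(\<lambda>y. W y $ 2 - ?P2 y) \<in> O[at 0](\<lambda>y. norm y ^ (k+1))"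
    and W3: "(\<lambda>y. W y $ 3 - ?P3 y) \<in> O[at 0](\<lambda>y. norm y ^ (k+1))"
    using W by (simp_all add: bruce_west_def)

  have lim2: "((\<lambda>x. (p x $ 1) ^ 1 * (p x $ 2) ^ 1 / s x ^ 3
        + (\<Sum>i=3..k. b i / fact i * ((p x $ 1) ^ 0 * (p x $ 2) ^ i / s x ^ 3))
        + (W (p x) $ 2 - ?P2 (p x)) / s x ^ 3)
      \<longlongrightarrow> (if 2 * 1 + 1 = (3::nat) then \<alpha> ^ 1 * \<beta> ^ 1 else 0)
        + (\<Sum>i=3..k. b i / fact i * (if 2 * 0 + i = 3 then \<alpha> ^ 0 * \<beta> ^ i else 0)) + 0) F"
    by (rule tendsto_add[OF tendsto_add[OF monomial tendsto_sum[OF tendsto_mult[OF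
                tendsto_const monomial]]] remainder[OF W2]]) (use k in simp_all)
  have sum2: "(\<Sum>i=3..k. b i / fact i * (if 2 * 0 + i = 3 then \<alpha> ^ 0 * \<beta> ^ i else 0))
      = b 3 / 6 * \<beta> ^ 3"
  proof -
    have "(\<Sum>i=3..k. b i / fact i * (if 2 * 0 + i = 3 then \<alpha> ^ 0 * \<beta> ^ i else 0))
        = (\<Sum>i=3..k. if i = 3 then b 3 / fact 3 * \<beta> ^ 3 else 0)"
      by (intro sum.cong) auto
    then show ?thesis using k by (simp add: fact_numeral)
  qed
  show second: ?second
    using lim2[unfolded sum2]
    by (simp add: add_divide_distrib diff_divide_distrib sum_divide_distrib)

  have one: "((\<lambda>x. W (p x) $ 1 / s x ^ 2) \<longlongrightarrow> \<alpha>) F"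
    using u
  proof (rule Lim_transform_eventually)
    show "\<forall>\<^sub>F x in F. p x $ 1 / s x ^ 2 = W (p x) $ 1 / s x ^ 2"
      using eventually_compose_filterlim[OF W1 p] by eventually_elim simp
  qed
  have "((\<lambda>x. W (p x) $ 2 / s x ^ 3 * s x) \<longlongrightarrow> (\<alpha> * \<beta> + b 3 / 6 * \<beta> ^ 3) * 0) F"
    by (intro tendsto_intros second s0)
  moreover have "\<forall>\<^sub>F x in F. W (p x) $ 2 / s x ^ 3 * s x = W (p x) $ 2 / s x ^ 2"
    using sn by eventually_elim (simp add: power3_eq_cube power2_eq_square)
  ultimately have two: "((\<lambda>x. W (p x) $ 2 / s x ^ 2) \<longlongrightarrow> (\<alpha> * \<beta> + b 3 / 6 * \<beta> ^ 3) * 0) F"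
    by (rule Lim_transform_eventually)

  have lim3: "((\<lambda>x. (\<Sum>r=2..k. \<Sum>(i,j)\<in>{(i,j). i + j = r}.
          a i j / (fact i * fact j) * ((p x $ 1) ^ i * (p x $ 2) ^ j / s x ^ 2))
        + (W (p x) $ 3 - ?P3 (p x)) / s x ^ 2)
      \<longlongrightarrow> (\<Sum>r=2..k. \<Sum>(i,j)\<in>{(i,j). i + j = r}.
          a i j / (fact i * fact j) * (if 2 * i + j = 2 then \<alpha> ^ i * \<beta> ^ j else 0)) + 0) F"
    unfolding split_def
    by (rule tendsto_add[OF tendsto_sum[OF tendsto_sum[OF tendsto_mult[OF
              tendsto_const monomial]]] remainder[OF W3, unfolded split_def]]) (use k in auto)
  have sum3: "(\<Sum>r=2..k. \<Sum>(i,j)\<in>{(i,j). i + j = r}.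
      a i j / (fact i * fact j) * (if 2 * i + j = 2 then \<alpha> ^ i * \<beta> ^ j else 0)) = a 0 2 / 2 * \<beta> ^ 2"
  proof -
    have "(\<Sum>(i,j)\<in>{(i,j). i + j = r}.
        a i j / (fact i * fact j) * (if 2 * i + j = 2 then \<alpha> ^ i * \<beta> ^ j else 0))
        = (if r = 2 then a 0 2 / 2 * \<beta> ^ 2 else 0)" if r: "r \<ge> 2" for r
    proof -
      let ?S = "{(i,j). i + j = r}"
        and ?t = "\<lambda>(i,j). a i j / (fact i * fact j) * (if 2 * i + j = 2 then \<alpha> ^ i * \<beta> ^ j else 0)"
      have fin: "finite ?S" by (rule finite_subset[of _ "{..r} \<times> {..r}"]) auto
      have "sum ?t ?S = sum ?t (?S \<inter> {(0, 2)})"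
      proof (rule sum.mono_neutral_right[OF fin])
        show "\<forall>y \<in> ?S - ?S \<inter> {(0, 2)}. ?t y = 0"
        proof
          fix y assume y: "y \<in> ?S - ?S \<inter> {(0, 2)}"
          obtain i j where ij: "y = (i, j)" by fastforce
          have "i + j = r" "(i, j) \<noteq> (0, 2)" using y ij by auto
          then have "2 * i + j \<noteq> 2" using r by (cases i) auto
          then show "?t y = 0" using ij by simp
        qed
      qed blast
      then show ?thesis by (cases "r = 2") (simp_all add: fact_numeral)
    qed
    then have "(\<Sum>r=2..k. \<Sum>(i,j)\<in>{(i,j). i + j = r}.
        a i j / (fact i * fact j) * (if 2 * i + j = 2 then \<alpha> ^ i * \<beta> ^ j else 0))
        = (\<Sum>r=2..k. if r = 2 then a 0 2 / 2 * \<beta> ^ 2 else 0)"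
      by (intro sum.cong) auto
    then show ?thesis using k by simp
  qed
  have P3: "(\<Sum>r=2..k. \<Sum>(i,j)\<in>{(i,j). i + j = r}.
      a i j / (fact i * fact j) * ((p x $ 1) ^ i * (p x $ 2) ^ j / s x ^ 2)) = ?P3 (p x) / s x ^ 2" for x
    unfolding sum_divide_distrib split_def by (simp only: times_divide_eq_right mult.assoc)
  have cancel: "z + (w - z) = w" for z w :: real by simp
  from lim3[unfolded sum3 P3]
  have three: "((\<lambda>x. W (p x) $ 3 / s x ^ 2) \<longlongrightarrow> a 0 2 / 2 * \<beta> ^ 2) F"
    by (simp only: diff_divide_distrib cancel add_0_right)

  show ?all
  proof (rule vec_tendstoI)
    have "(W (p x) /\<^sub>R s x ^ 2) $ i = W (p x) $ i / s x ^ 2" for x i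
      by (simp add: divide_inverse_commute)
    then show "((\<lambda>x. (W (p x) /\<^sub>R s x ^ 2) $ i)
        \<longlongrightarrow> (vector [\<alpha>, 0, a 0 2 / 2 * \<beta> ^ 2] :: real^3) $ i) F" for i
      using exhaust_3[of i] one two[unfolded mult_zero_right] three
      by (elim disjE) (simp_all only: vector_3)
  qed
qed


section \<open>The double-point curve\<close>

text \<open>
  Since \<open>W\<close> has the same value at \<open>d x\<close> and \<open>d (- x)\<close>, its first component forces \<open>d\<^sub>1\<close> to be
  even, so \<open>d\<^sub>1 = O(x\<^sup>2)\<close> and the nonzero derivative of \<open>d\<close> lies in the second coordinate. The
  second component of \<open>W\<close> along \<open>d\<close> is even as well, so its coefficient of \<open>x\<^sup>3\<close>, computed from
  the normal form, vanishes; this expresses the quadratic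
  coefficient of \<open>d\<^sub>1\<close> by the derivative \<open>\<beta>\<close> of \<open>d\<^sub>2\<close>.
\<close>

lemma double_point_curve_leading_terms:
  assumes W: "bruce_west k a b W" and k: "k \<ge> 3" and d: "double_point_curve W d"
  obtains \<beta> where "\<beta> \<noteq> 0" "((\<lambda>x. d x $ 2 / x) \<longlongrightarrow> \<beta>) (at 0)"
    "((\<lambda>x. d x $ 1 / x ^ 2) \<longlongrightarrow> - (b 3 / 6) * \<beta> ^ 2) (at 0)"
proof -
  have sm: "smooth_near 0 d" and d0: "d 0 = 0" and D: "vector_derivative d (at 0) \<noteq> 0"
    and ev: "\<forall>\<^sub>F x in nhds 0. W (d x) = W (d (- x))"
    using d by (auto simp: double_point_curve_def map_germ_def)
  have lim_d: "(d \<longlongrightarrow> 0) (nhds 0)"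
    using smooth_near_isCont[OF sm] d0 tendsto_at_iff_tendsto_nhds[of d 0] by (simp add: isCont_def)
  have neg: "filterlim uminus (nhds 0) (nhds (0::real))"
    using tendsto_minus[of "\<lambda>x. x" "0::real" "nhds 0"] by (simp add: filterlim_ident)
  have neg_at: "filterlim uminus (at 0) (at (0::real))"
    by (simp add: filterlim_at filterlim_mono[OF neg order.refl at_within_le_nhds]
        eventually_neq_at_within)

  obtain q where q: "smooth_near 0 q" "\<forall>\<^sub>F x in nhds 0. d x = x *\<^sub>R q x"
    using smooth_near_divide_by_variable[OF sm d0] by blast
  have q0: "(q \<longlongrightarrow> q 0) (at 0)"
    using smooth_near_isCont[OF q(1)] by (simp add: isCont_def)
  have "((\<lambda>x. x *\<^sub>R q x) has_vector_derivative q 0) (at 0)"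
    using has_vector_derivative_scaleR[OF DERIV_ident eventually_nhds_x_imp_x[OF
          smooth_near_has_vector_derivative[OF q(1)]]] by simp
  moreover have near: "\<forall>\<^sub>F x in nhds 0. x *\<^sub>R q x = d x" using q(2) by eventually_elim simp
  ultimately have "(d has_vector_derivative q 0) (at 0)"
    unfolding has_vector_derivative_def
    using has_derivative_transform_eventually[OF _ eventually_nhds_imp_at[OF near]
        eventually_nhds_x_imp_x[OF near]] by simp
  then have q_nz: "q 0 \<noteq> 0" using D vector_derivative_at[of d "q 0" 0] by simp

  have "\<forall>\<^sub>F y in nhds 0. W y $ 1 = y $ 1" using W by (simp add: bruce_west_def)
  from eventually_compose_filterlim[OF this lim_d]
  have W1: "\<forall>\<^sub>F x in nhds 0. W (d x) $ 1 = d x $ 1" .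
  have "\<forall>\<^sub>F x in nhds 0. d x $ 1 = d (- x) $ 1"
    using ev W1 eventually_compose_filterlim[OF W1 neg] by eventually_elim simp
  then have "\<forall>\<^sub>F x in at 0. - q (- x) $ 1 = q x $ 1"
    using q(2) eventually_compose_filterlim[OF q(2) neg] unfolding eventually_at_filter
  proof eventually_elim
    case (elim x)
    have "x * q x $ 1 = x * (- q (- x) $ 1)" using elim by simp
    then show ?case by (metis mult_left_cancel)
  qed
  moreover have "((\<lambda>x. - q (- x) $ 1) \<longlongrightarrow> - q 0 $ 1) (at 0)"
    by (intro tendsto_intros filterlim_compose[OF q0 neg_at])
  ultimately have "((\<lambda>x. q x $ 1) \<longlongrightarrow> - q 0 $ 1) (at 0)"
    by (rule Lim_transform_eventually[rotated])
  moreover have "((\<lambda>x. q x $ 1) \<longlongrightarrow> q 0 $ 1) (at 0)" by (intro tendsto_intros q0)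
  ultimately have "- q 0 $ 1 = q 0 $ 1" by (rule LIM_unique)
  then have q01: "q 0 $ 1 = 0" by simp
  define \<beta> where "\<beta> = q 0 $ 2"
  have "\<beta> \<noteq> 0" using q_nz q01 by (auto simp: \<beta>_def vec_eq_iff forall_2)
  have "((\<lambda>x. q x $ 2) \<longlongrightarrow> \<beta>) (at 0)" unfolding \<beta>_def by (intro tendsto_intros q0)
  moreover have "\<forall>\<^sub>F x in at 0. q x $ 2 = d x $ 2 / x"
    using q(2) unfolding eventually_at_filter by eventually_elim auto
  ultimately have v: "((\<lambda>x. d x $ 2 / x) \<longlongrightarrow> \<beta>) (at 0)" by (rule Lim_transform_eventually)

  have smq: "smooth_near 0 (\<lambda>x. q x $ 1)"
    using smooth_near_bounded_linear[OF bounded_linear_vec_nth q(1)] .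
  obtain h where h: "smooth_near 0 h" "\<forall>\<^sub>F x in nhds 0. q x $ 1 = x *\<^sub>R h x"
    using smooth_near_divide_by_variable[OF smq q01] by blast
  have "(h \<longlongrightarrow> h 0) (at 0)" using smooth_near_isCont[OF h(1)] by (simp add: isCont_def)
  moreover have "\<forall>\<^sub>F x in at 0. h x = d x $ 1 / x ^ 2"
    using q(2) h(2) unfolding eventually_at_filter
    by eventually_elim (auto simp: power2_eq_square)
  ultimately have u: "((\<lambda>x. d x $ 1 / x ^ 2) \<longlongrightarrow> h 0) (at 0)" by (rule Lim_transform_eventually)

  \<comment> \<open>The reflection \<open>x \<mapsto> - x\<close> leaves \<open>W (d x)\<close> unchanged but negates \<open>x\<^sup>3\<close>.\<close>
  let ?c = "h 0 * \<beta> + b 3 / 6 * \<beta> ^ 3"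
  have cubic: "((\<lambda>x. W (d x) $ 2 / x ^ 3) \<longlongrightarrow> ?c) (at 0)"
    using filterlim_mono[OF lim_d order.refl at_within_le_nhds]
    by (intro bruce_west_leading_terms(1)[OF W k _ u v _ \<open>\<beta> \<noteq> 0\<close>]) (auto simp: filterlim_ident)
  have "((\<lambda>x. - (W (d (- x)) $ 2 / (- x) ^ 3)) \<longlongrightarrow> - ?c) (at 0)"
    by (intro tendsto_minus filterlim_compose[OF cubic neg_at])
  moreover have "\<forall>\<^sub>F x in at 0. - (W (d (- x)) $ 2 / (- x) ^ 3) = W (d x) $ 2 / x ^ 3"
    using eventually_nhds_imp_at[OF ev] by eventually_elim simp
  ultimately have "((\<lambda>x. W (d x) $ 2 / x ^ 3) \<longlongrightarrow> - ?c) (at 0)"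
    by (rule Lim_transform_eventually)
  with cubic have "?c = - ?c" by (rule LIM_unique)
  then have "\<beta> * (h 0 + b 3 / 6 * \<beta> ^ 2) = 0"
    by (simp add: algebra_simps power3_eq_cube power2_eq_square)
  then have "h 0 = - (b 3 / 6) * \<beta> ^ 2" using \<open>\<beta> \<noteq> 0\<close> by simp
  with u v \<open>\<beta> \<noteq> 0\<close> show thesis using that by simp
qed


section \<open>The tangency criterion\<close>

theorem theorem3p4:
  fixes W :: "real^2 \<Rightarrow> real^3"
    and a :: "nat \<Rightarrow> nat \<Rightarrow> real" and b c :: "nat \<Rightarrow> real"
    and k m :: nat
    and C :: "real \<Rightarrow> real"
    and c\<^sub>w d :: "real \<Rightarrow> real^2"
    and \<gamma> :: "real \<Rightarrow> real^3"
    and B :: real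
  assumes "k \<ge> 3"
    and "whitney_umbrella W"
    and "bruce_west k a b W"
    and "m \<ge> 1"
    and "taylor_at_0 C c"
    and "c\<^sub>w = (\<lambda>x. vector [x^(2*m) * C x, x^m])"
    and "\<gamma> = W \<circ> c\<^sub>w"
    and "double_point_curve W d"
    and "B = 3 * c 0 + b 3 / 2"
  shows "\<gamma> 0 = 0 \<and>
    (\<exists>L. tangent_line_at_0 \<gamma> L) \<and> (\<exists>L. tangent_line_at_0 (W \<circ> d) L) \<and>
    (tangent_at_0 \<gamma> (W \<circ> d) \<longleftrightarrow> B = 0)"
proof -
  note k = \<open>k \<ge> 3\<close> and W = \<open>bruce_west k a b W\<close>
  have W0: "W 0 = 0" and smW: "smooth_near 0 W" and a02: "a 0 2 \<noteq> 0"
    using W by (auto simp: bruce_west_def map_germ_def)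
  have smd: "smooth_near 0 d" and d0: "d 0 = 0"
    using \<open>double_point_curve W d\<close> by (auto simp: double_point_curve_def map_germ_def)
  have smC: "smooth_near 0 C" and C0: "C 0 = c 0"
    using \<open>taylor_at_0 C c\<close> unfolding taylor_at_0_def by (auto dest: spec[of _ 0])

  have cw: "c\<^sub>w = (\<lambda>x. (x ^ (2*m) * C x) *\<^sub>R axis 1 1 + (x ^ m) *\<^sub>R axis 2 1)"
    unfolding assms(6) by (auto simp: vec_eq_iff forall_2 axis_def)
  have cw0: "c\<^sub>w 0 = 0" unfolding cw using \<open>m \<ge> 1\<close> by (simp add: power_0_left)
  have smcw: "smooth_near 0 c\<^sub>w"
    unfolding cw real_scaleR_def[symmetric]
    by (intro smooth_near_add smooth_near_scaleR smooth_near_const smooth_near_power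
        smooth_near_ident smC)
  have sm\<gamma>: "smooth_near 0 \<gamma>" and \<gamma>0: "\<gamma> 0 = 0"
    using smooth_near_compose[OF smcw] smW cw0 W0 by (simp_all add: assms(7) o_def)
  have smWd: "smooth_near 0 (W \<circ> d)" and Wd0: "(W \<circ> d) 0 = 0"
    using smooth_near_compose[OF smd] smW d0 W0 by (simp_all add: o_def)

  let ?v = "vector [c 0, 0, a 0 2 / 2] :: real^3"
  have "((\<lambda>x. W (c\<^sub>w x) /\<^sub>R (x ^ m) ^ 2) \<longlongrightarrow> vector [c 0, 0, a 0 2 / 2 * 1 ^ 2]) (at 0)"
  proof (rule bruce_west_leading_terms(2)[OF W k])
    have "((\<lambda>x::real. x ^ m) \<longlongrightarrow> 0 ^ m) (at 0)" by (intro tendsto_intros)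
    then show "filterlim (\<lambda>x::real. x ^ m) (at 0) (at 0)"
      using \<open>m \<ge> 1\<close> by (auto simp: filterlim_at power_0_left eventually_at_filter)
    have "(C \<longlongrightarrow> c 0) (at 0)" using smooth_near_isCont[OF smC] C0 by (simp add: isCont_def)
    moreover have "\<forall>\<^sub>F x in at 0. C x = c\<^sub>w x $ 1 / (x ^ m) ^ 2"
      by (simp add: eventually_at_filter assms(6) mult.commute flip: power_mult)
    ultimately show "((\<lambda>x. c\<^sub>w x $ 1 / (x ^ m) ^ 2) \<longlongrightarrow> c 0) (at 0)"
      by (rule Lim_transform_eventually)
    have "\<forall>\<^sub>F x in at 0. 1 = c\<^sub>w x $ 2 / x ^ m"
      by (simp add: eventually_at_filter assms(6))
    with tendsto_const show "((\<lambda>x. c\<^sub>w x $ 2 / x ^ m) \<longlongrightarrow> 1) (at 0)"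
      by (rule Lim_transform_eventually)
    show "(c\<^sub>w \<longlongrightarrow> 0) (at 0)" using smooth_near_isCont[OF smcw] cw0 by (simp add: isCont_def)
  qed simp
  then have "((\<lambda>x. \<gamma> x /\<^sub>R x ^ (2*m)) \<longlongrightarrow> ?v) (at 0)"
    by (simp add: assms(7) mult.commute flip: power_mult)
  moreover have v3: "?v $ 3 \<noteq> 0" using a02 by simp
  then have "?v \<noteq> 0" by (metis zero_index)
  ultimately have L: "tangent_line_at_0 \<gamma> (span {?v})"
    using \<open>m \<ge> 1\<close> by (intro tangent_line_at_0_leading_coefficient[OF sm\<gamma> \<gamma>0]) auto

  obtain \<beta> where \<beta>: "\<beta> \<noteq> 0" "((\<lambda>x. d x $ 2 / x) \<longlongrightarrow> \<beta>) (at 0)"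
      "((\<lambda>x. d x $ 1 / x ^ 2) \<longlongrightarrow> - (b 3 / 6) * \<beta> ^ 2) (at 0)"
    using double_point_curve_leading_terms[OF W k \<open>double_point_curve W d\<close>] by blast
  \<comment> \<open>The unknown speed \<open>\<beta>\<close> of \<open>d\<close> only scales the leading coefficient, by \<open>\<beta>\<^sup>2\<close>.\<close>
  let ?w = "vector [- (b 3 / 6), 0, a 0 2 / 2] :: real^3"
  have "((\<lambda>x. W (d x) /\<^sub>R x ^ 2)
      \<longlongrightarrow> vector [- (b 3 / 6) * \<beta> ^ 2, 0, a 0 2 / 2 * \<beta> ^ 2]) (at 0)"
    using smooth_near_isCont[OF smd] d0
    by (intro bruce_west_leading_terms(2)[OF W k _ \<beta>(3,2) _ \<beta>(1)])
      (auto simp: isCont_def filterlim_ident)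
  also have "vector [- (b 3 / 6) * \<beta> ^ 2, 0, a 0 2 / 2 * \<beta> ^ 2] = \<beta> ^ 2 *\<^sub>R ?w"
    by (simp add: vec_eq_iff forall_3)
  finally have "((\<lambda>x. (W \<circ> d) x /\<^sub>R x ^ 2) \<longlongrightarrow> \<beta> ^ 2 *\<^sub>R ?w) (at 0)"
    by simp
  moreover have w3: "?w $ 3 \<noteq> 0" using a02 by simp
  then have "\<beta> ^ 2 *\<^sub>R ?w \<noteq> 0" using \<beta>(1) by (metis power_not_zero scaleR_eq_0_iff zero_index)
  ultimately have "tangent_line_at_0 (W \<circ> d) (span {\<beta> ^ 2 *\<^sub>R ?w})"
    by (intro tangent_line_at_0_leading_coefficient[OF smWd Wd0]) auto
  then have L': "tangent_line_at_0 (W \<circ> d) (span {?w})"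
    using \<beta>(1) by (simp add: span_singleton_scaleR)

  have "tangent_at_0 \<gamma> (W \<circ> d) \<longleftrightarrow> span {?v} = span {?w}"
    unfolding tangent_at_0_def
    using L L' tangent_line_at_0_unique by metis
  also have "\<dots> \<longleftrightarrow> c 0 = - (b 3 / 6)"
  proof
    assume "span {?v} = span {?w}"
    then have "?v \<in> span {?w}" by (metis span_base singletonI)
    then obtain t where t: "?v = t *\<^sub>R ?w" by (auto simp: span_singleton)
    from arg_cong[OF t, of "\<lambda>y. y $ 3"] have "t = 1" using a02 by simp
    with arg_cong[OF t, of "\<lambda>y. y $ 1"] show "c 0 = - (b 3 / 6)" by simp
  qed simp
  also have "\<dots> \<longleftrightarrow> B = 0" unfolding assms(9) by auto
  finally show ?thesis using \<gamma>0 L L' by blast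
qed

end
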